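(* Let $n\ge 2$, let $t$ be an indeterminate, let $k\in\mathbb{Z}$, and let $x_1,\ldots,x_n$ be the standard basis of $\mathbb{Z}[t^{\pm1}]^n$. For $1\le i\le n-1$ let $\mu(\ell_i)$ be the $\mathbb{Z}[t^{\pm1}]$-linear map given by \[ x_i\longmapsto t^k x_{i+1},\qquad x_{i+1}\longmapsto t^{-k}x_i,\qquad x_j\longmapsto x_j \ \text{ for } j\notin\{i,i+1\}. \] Then $\mu$ defines a representation $\mu:L_n\longrightarrow \mathrm{GL}_n(\mathbb{Z}[t^{\pm1}])$ of the triplet group $L_n$.
   Context: The triplet group $L_n$ is the group generated by $\ell_1,\ldots,\ell_{n-1}$ subject to the relations $\ell_i^2=1$ for $1\le i\le n-1$ and $\ell_i\ell_{i+1}\ell_i=\ell_{i+1}\ell_i\ell_{i+1}$ for $1\le i\le n-2$ (no commutation relations are imposed). *)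

theory Defs
  imports
    "HOL-Algebra.Group"
    "HOL-Library.Poly_Mapping"
    "Jordan_Normal_Form.Matrix"
begin

section \<open>Groups given by generators and relations\<close>

datatype 'a letter = Gen 'a | GenInv 'a

definition words :: "'a set \<Rightarrow> 'a letter list set"
  where "words X = lists (Gen ` X \<union> GenInv ` X)"

text \<open>
  A pair \<open>(u, v)\<close> in \<open>R\<close> stands for the relation \<open>u = v\<close>. The relation below is the least
  congruence on the words over \<open>X\<close> that contains \<open>R\<close> and makes \<open>GenInv x\<close> a two-sided inverse
  of \<open>Gen x\<close>; the quotient is therefore the free group on \<open>X\<close> modulo the normal closure
  of the elements \<open>u v\<^sup>-\<^sup>1\<close> with \<open>(u, v)\<close> in \<open>R\<close>.
\<close>

inductive_set pres_rel :: "'a set \<Rightarrow> ('a letter list \<times> 'a letter list) set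
    \<Rightarrow> ('a letter list \<times> 'a letter list) set"
  for X R
where
  refl: "w \<in> words X \<Longrightarrow> (w, w) \<in> pres_rel X R"
| sym: "(u, v) \<in> pres_rel X R \<Longrightarrow> (v, u) \<in> pres_rel X R"
| trans: "(u, v) \<in> pres_rel X R \<Longrightarrow> (v, w) \<in> pres_rel X R \<Longrightarrow> (u, w) \<in> pres_rel X R"
| cong: "(u, v) \<in> pres_rel X R \<Longrightarrow> a \<in> words X \<Longrightarrow> b \<in> words X
    \<Longrightarrow> (a @ u @ b, a @ v @ b) \<in> pres_rel X R"
| right_inv: "x \<in> X \<Longrightarrow> ([Gen x, GenInv x], []) \<in> pres_rel X R"
| left_inv: "x \<in> X \<Longrightarrow> ([GenInv x, Gen x], []) \<in> pres_rel X R"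
| relation: "(u, v) \<in> R \<Longrightarrow> u \<in> words X \<Longrightarrow> v \<in> words X \<Longrightarrow> (u, v) \<in> pres_rel X R"

definition word_class :: "'a set \<Rightarrow> ('a letter list \<times> 'a letter list) set
    \<Rightarrow> 'a letter list \<Rightarrow> 'a letter list set"
  where "word_class X R w = pres_rel X R `` {w}"

definition presented_group :: "'a set \<Rightarrow> ('a letter list \<times> 'a letter list) set
    \<Rightarrow> 'a letter list set monoid"
  where "presented_group X R =
    \<lparr>carrier = words X // pres_rel X R,
     mult = (\<lambda>A B. \<Union>u\<in>A. \<Union>v\<in>B. word_class X R (u @ v)),
     one = word_class X R []\<rparr>"

section \<open>The triplet group\<close>

definition triplet_gens :: "nat \<Rightarrow> nat set"
  where "triplet_gens n = {1..n - 1}"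

definition triplet_rels :: "nat \<Rightarrow> (nat letter list \<times> nat letter list) set"
  where "triplet_rels n =
    {([Gen i, Gen i], []) | i. 1 \<le> i \<and> i \<le> n - 1} \<union>
    {([Gen i, Gen (i + 1), Gen i], [Gen (i + 1), Gen i, Gen (i + 1)]) | i. 1 \<le> i \<and> i \<le> n - 2}"

definition triplet_group :: "nat \<Rightarrow> nat letter list set monoid"
  where "triplet_group n = presented_group (triplet_gens n) (triplet_rels n)"

definition triplet_gen :: "nat \<Rightarrow> nat \<Rightarrow> nat letter list set"
  where "triplet_gen n i = word_class (triplet_gens n) (triplet_rels n) [Gen i]"

section \<open>Laurent polynomials and the general linear group\<close>

text \<open>
  Finitely supported functions from \<open>int\<close> to \<open>int\<close> with the convolution product of
  \<^theory>\<open>HOL-Library.Poly_Mapping\<close>: the group ring of the integers over the integers, where the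
  coefficient at \<open>m\<close> is that of the \<open>m\<close>-th power of the indeterminate.
\<close>

type_synonym laurent_poly = "int \<Rightarrow>\<^sub>0 int"

definition t_pow :: "int \<Rightarrow> laurent_poly"
  where "t_pow k = Poly_Mapping.single k 1"

lemma t_pow_0: "t_pow 0 = 1"
  by (simp add: t_pow_def)

lemma t_pow_add: "t_pow (a + b) = t_pow a * t_pow b"
  by (simp add: t_pow_def mult_single)

definition GL :: "'a :: comm_ring_1 itself \<Rightarrow> nat \<Rightarrow> 'a mat monoid"
  where "GL ty n = units_of (ring_mat ty n ())"

text \<open>Library vectors are indexed from 0, the basis \<open>x\<^sub>1, \<dots>, x\<^sub>n\<close> from 1.\<close>

definition std_basis :: "nat \<Rightarrow> nat \<Rightarrow> laurent_poly vec"
  where "std_basis n j = unit_vec n (j - 1)"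

end

theory Submission
  imports Defs "HOL-Combinatorics.Transposition"
begin

text \<open>
  Powers of \<open>t\<close> are units, so \<open>y\<^sub>j = t\<^bsup>k j\<^esup> x\<^sub>j\<close> is another basis of the same free module over the
  Laurent polynomials. In it the map prescribed for the generator \<open>i\<close> merely swaps \<open>y\<^sub>i\<close> and
  \<open>y\<^bsub>i+1\<^esub>\<close>. The prescribed matrices are therefore the permutation matrices of adjacent
  transpositions conjugated by one diagonal matrix (\<open>twisted_perm_mat\<close>), so they satisfy the
  relations that the transpositions satisfy in the symmetric group: involutivity and the braid
  relation (\<open>twisted_transpose_square\<close>, \<open>twisted_transpose_braid\<close>).

  The passage from generators to the whole group is the universal property of a presentation
  (\<open>presented_group_universal\<close>): values on the generators that respect the relations extend
  to exactly one homomorphism. Since a matrix is determined by its action on the standard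
  basis (\<open>eq_twisted_transpose_iff\<close>), the three prescribed actions fix the values on
  generators, and existence and uniqueness both follow.
\<close>

section \<open>The universal property of a presentation\<close>

lemma words_Nil: "[] \<in> words X"
  by (simp add: words_def)

lemma words_append: "u @ v \<in> words X \<longleftrightarrow> u \<in> words X \<and> v \<in> words X"
  by (auto simp: words_def)

lemma words_Cons: "l # w \<in> words X \<longleftrightarrow> l \<in> Gen ` X \<union> GenInv ` X \<and> w \<in> words X"
  by (auto simp: words_def)

lemma pres_rel_words:
  assumes "(u, v) \<in> pres_rel X R"
  shows "u \<in> words X" "v \<in> words X"
  using assms by (induction rule: pres_rel.induct) (auto simp: words_append words_Cons words_Nil)

lemma equiv_pres_rel: "equiv (words X) (pres_rel X R)"
proof (rule equivI)
  show "pres_rel X R \<subseteq> words X \<times> words X"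
    by (auto dest: pres_rel_words)
  show "refl_on (words X) (pres_rel X R)"
    by (auto simp: refl_on_def intro: pres_rel.refl)
  show "sym (pres_rel X R)"
    by (auto intro: symI pres_rel.sym)
  show "trans (pres_rel X R)"
    by (auto intro: transI pres_rel.trans)
qed

lemma word_class_eq_iff:
  assumes "u \<in> words X" "v \<in> words X"
  shows "word_class X R u = word_class X R v \<longleftrightarrow> (u, v) \<in> pres_rel X R"
  unfolding word_class_def using eq_equiv_class_iff[OF equiv_pres_rel assms] .

lemma pres_rel_append:
  assumes "(u, u') \<in> pres_rel X R" "(v, v') \<in> pres_rel X R"
  shows "(u @ v, u' @ v') \<in> pres_rel X R"
proof (rule pres_rel.trans)
  show "(u @ v, u' @ v) \<in> pres_rel X R"
    using pres_rel.cong[OF assms(1) words_Nil pres_rel_words(1)[OF assms(2)]] by simp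
  show "(u' @ v, u' @ v') \<in> pres_rel X R"
    using pres_rel.cong[OF assms(2) pres_rel_words(2)[OF assms(1)] words_Nil] by simp
qed

text \<open>
  The product in the quotient is a union over all representatives; since concatenation respects
  the congruence, every member of that union is the same class.
\<close>

lemma word_class_mult:
  assumes "u \<in> words X" "v \<in> words X"
  shows "word_class X R u \<otimes>\<^bsub>presented_group X R\<^esub> word_class X R v = word_class X R (u @ v)"
proof -
  have eq: "word_class X R (u' @ v') = word_class X R (u @ v)"
    if "u' \<in> word_class X R u" "v' \<in> word_class X R v" for u' v'
    using that pres_rel_append[of u u' X R v v'] equiv_class_eq[OF equiv_pres_rel]
    by (fastforce simp: word_class_def)
  have "u \<in> word_class X R u" "v \<in> word_class X R v"
    using assms by (auto simp: word_class_def intro: pres_rel.refl)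
  with eq show ?thesis
    unfolding presented_group_def monoid.simps by blast
qed

lemma one_presented_group: "\<one>\<^bsub>presented_group X R\<^esub> = word_class X R []"
  by (simp add: presented_group_def)

lemma carrier_presented_group: "carrier (presented_group X R) = word_class X R ` words X"
  by (auto simp: presented_group_def quotient_def word_class_def)

fun inv_letter :: "'a letter \<Rightarrow> 'a letter" where
  "inv_letter (Gen x) = GenInv x"
| "inv_letter (GenInv x) = Gen x"

lemma inv_word_cancel:
  assumes "w \<in> words X"
  shows "rev (map inv_letter w) \<in> words X \<and> (rev (map inv_letter w) @ w, []) \<in> pres_rel X R"
  using assms
proof (induction w)
  case Nil
  then show ?case by (simp add: words_Nil pres_rel.refl)
next
  case (Cons l w)
  let ?v = "rev (map inv_letter w)"
  from Cons have v: "?v \<in> words X" and IH: "(?v @ w, []) \<in> pres_rel X R"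
    and w: "w \<in> words X" and l: "l \<in> Gen ` X \<union> GenInv ` X"
    by (auto simp: words_Cons)
  have "([inv_letter l, l], []) \<in> pres_rel X R"
    using l by (auto intro: pres_rel.left_inv pres_rel.right_inv)
  from pres_rel.cong[OF this v w] IH
  have "(?v @ [inv_letter l, l] @ w, []) \<in> pres_rel X R"
    by (auto intro: pres_rel.trans)
  moreover have "inv_letter l \<in> Gen ` X \<union> GenInv ` X"
    using l by auto
  ultimately show ?case
    using v by (simp add: words_append words_Cons words_Nil)
qed

lemma group_presented_group: "group (presented_group X R)"
proof (rule groupI)
  fix A assume "A \<in> carrier (presented_group X R)"
  then obtain w where w: "w \<in> words X" "A = word_class X R w"
    by (auto simp: carrier_presented_group)
  let ?v = "rev (map inv_letter w)"
  have "word_class X R ?v \<otimes>\<^bsub>presented_group X R\<^esub> A = \<one>\<^bsub>presented_group X R\<^esub>"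
    using inv_word_cancel[OF w(1), of R] w
    by (simp add: word_class_mult one_presented_group word_class_eq_iff words_append words_Nil)
  then show "\<exists>B\<in>carrier (presented_group X R). B \<otimes>\<^bsub>presented_group X R\<^esub> A = \<one>\<^bsub>presented_group X R\<^esub>"
    using inv_word_cancel[OF w(1)] by (auto simp: carrier_presented_group)
next
  fix A B C
  assume "A \<in> carrier (presented_group X R)" "B \<in> carrier (presented_group X R)"
    "C \<in> carrier (presented_group X R)"
  then show "A \<otimes>\<^bsub>presented_group X R\<^esub> B \<otimes>\<^bsub>presented_group X R\<^esub> C
      = A \<otimes>\<^bsub>presented_group X R\<^esub> (B \<otimes>\<^bsub>presented_group X R\<^esub> C)"
    by (auto simp: carrier_presented_group word_class_mult words_append)
next
  fix A B
  assume "A \<in> carrier (presented_group X R)" "B \<in> carrier (presented_group X R)"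
  then show "A \<otimes>\<^bsub>presented_group X R\<^esub> B \<in> carrier (presented_group X R)"
    by (auto simp: carrier_presented_group word_class_mult words_append)
next
  show "\<one>\<^bsub>presented_group X R\<^esub> \<in> carrier (presented_group X R)"
    by (simp add: carrier_presented_group one_presented_group words_Nil)
next
  fix A assume "A \<in> carrier (presented_group X R)"
  then show "\<one>\<^bsub>presented_group X R\<^esub> \<otimes>\<^bsub>presented_group X R\<^esub> A = A"
    by (auto simp: carrier_presented_group one_presented_group word_class_mult words_Nil)
qed

fun letter_val :: "('g, 'm) monoid_scheme \<Rightarrow> ('a \<Rightarrow> 'g) \<Rightarrow> 'a letter \<Rightarrow> 'g" where
  "letter_val G f (Gen x) = f x"
| "letter_val G f (GenInv x) = inv\<^bsub>G\<^esub> f x"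

definition word_val :: "('g, 'm) monoid_scheme \<Rightarrow> ('a \<Rightarrow> 'g) \<Rightarrow> 'a letter list \<Rightarrow> 'g"
  where "word_val G f w = foldr (\<lambda>l y. letter_val G f l \<otimes>\<^bsub>G\<^esub> y) w \<one>\<^bsub>G\<^esub>"

lemma word_val_simps:
  "word_val G f [] = \<one>\<^bsub>G\<^esub>"
  "word_val G f (l # w) = letter_val G f l \<otimes>\<^bsub>G\<^esub> word_val G f w"
  by (simp_all add: word_val_def)

context group
begin

lemma letter_val_closed:
  assumes "f \<in> X \<rightarrow> carrier G" "l \<in> Gen ` X \<union> GenInv ` X"
  shows "letter_val G f l \<in> carrier G"
  using assms by (auto intro!: inv_closed)

lemma word_val_closed:
  assumes "f \<in> X \<rightarrow> carrier G" "w \<in> words X"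
  shows "word_val G f w \<in> carrier G"
  using assms(2)
  by (induction w) (auto simp: word_val_simps words_Cons letter_val_closed[OF assms(1)])

lemma word_val_append:
  assumes f: "f \<in> X \<rightarrow> carrier G" and "u \<in> words X" "v \<in> words X"
  shows "word_val G f (u @ v) = word_val G f u \<otimes> word_val G f v"
  using assms(2)
proof (induction u)
  case Nil
  then show ?case by (simp add: word_val_simps word_val_closed[OF f assms(3)])
next
  case (Cons l u)
  then show ?case
    using letter_val_closed[OF f, of l] word_val_closed[OF f, of u]
      word_val_closed[OF f assms(3)]
    by (simp add: word_val_simps words_Cons m_assoc del: Un_iff)
qed

text \<open>
  Having equal values is itself a congruence that contains the relations and cancels inverse
  letters, so it contains the least such congruence.
\<close>

lemma word_val_pres_rel:
  assumes f: "f \<in> X \<rightarrow> carrier G"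
    and R: "\<And>u v. (u, v) \<in> R \<Longrightarrow> u \<in> words X \<Longrightarrow> v \<in> words X \<Longrightarrow> word_val G f u = word_val G f v"
    and "(u, v) \<in> pres_rel X R"
  shows "word_val G f u = word_val G f v"
  using assms(3)
proof (induction rule: pres_rel.induct)
  case (cong u v a b)
  then show ?case
    using pres_rel_words[OF cong(1)] by (simp add: word_val_append[OF f] words_append)
next
  case (right_inv x)
  then have "f x \<in> carrier G" using f by auto
  then show ?case by (simp add: word_val_simps)
next
  case (left_inv x)
  then have "f x \<in> carrier G" using f by auto
  then show ?case by (simp add: word_val_simps)
qed (use R in auto)

text \<open>
  A homomorphism is thus determined by its values on the generators, which is the uniqueness half
  of the universal property.
\<close>

lemma hom_word_class:
  assumes "\<phi> \<in> hom (presented_group X R) G" "w \<in> words X"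
  shows "\<phi> (word_class X R w) = word_val G (\<lambda>x. \<phi> (word_class X R [Gen x])) w"
proof -
  interpret \<phi>: group_hom "presented_group X R" G \<phi>
    using assms(1) group_presented_group is_group
    by (simp add: group_hom_def group_hom_axioms_def)
  have letter: "\<phi> (word_class X R [l]) = letter_val G (\<lambda>x. \<phi> (word_class X R [Gen x])) l"
    if "l \<in> Gen ` X \<union> GenInv ` X" for l
  proof (cases l)
    case (GenInv x)
    with that have x: "x \<in> X" by auto
    then have carr: "word_class X R [Gen x] \<in> carrier (presented_group X R)"
      "word_class X R [GenInv x] \<in> carrier (presented_group X R)"
      by (auto simp: carrier_presented_group words_Cons words_Nil)
    have "word_class X R [GenInv x] \<otimes>\<^bsub>presented_group X R\<^esub> word_class X R [Gen x]
        = \<one>\<^bsub>presented_group X R\<^esub>"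
      using x pres_rel.left_inv[OF x, of R]
      by (simp add: word_class_mult one_presented_group word_class_eq_iff words_Cons words_Nil)
    then have "word_class X R [GenInv x] = inv\<^bsub>presented_group X R\<^esub> word_class X R [Gen x]"
      using carr by (metis \<phi>.G.inv_equality)
    then show ?thesis using GenInv carr by simp
  qed simp
  show ?thesis
    using assms(2)
  proof (induction w)
    case Nil
    then show ?case
      using \<phi>.hom_one by (simp add: word_val_simps one_presented_group)
  next
    case (Cons l w)
    then have lw: "[l] \<in> words X" "w \<in> words X" "l \<in> Gen ` X \<union> GenInv ` X"
      by (auto simp: words_Cons words_Nil)
    have "\<phi> (word_class X R (l # w))
        = \<phi> (word_class X R [l] \<otimes>\<^bsub>presented_group X R\<^esub> word_class X R w)"
      using lw by (simp add: word_class_mult)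
    also have "\<dots> = \<phi> (word_class X R [l]) \<otimes> \<phi> (word_class X R w)"
      using lw by (intro \<phi>.hom_mult) (auto simp: carrier_presented_group)
    finally show ?case
      using Cons lw letter by (simp add: word_val_simps)
  qed
qed

theorem presented_group_universal:
  assumes f: "f \<in> X \<rightarrow> carrier G"
    and R: "\<And>u v. (u, v) \<in> R \<Longrightarrow> u \<in> words X \<Longrightarrow> v \<in> words X \<Longrightarrow> word_val G f u = word_val G f v"
  shows "\<exists>!\<phi>. \<phi> \<in> extensional (carrier (presented_group X R)) \<and>
    \<phi> \<in> hom (presented_group X R) G \<and> (\<forall>x\<in>X. \<phi> (word_class X R [Gen x]) = f x)"
proof (rule ex_ex1I)
  let ?P = "presented_group X R"
  \<comment> \<open>Evaluation is constant on each class, so an arbitrary representative will do.\<close>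
  define \<phi> where "\<phi> = (\<lambda>A\<in>carrier ?P. word_val G f (SOME w. w \<in> A))"
  have \<phi>: "\<phi> (word_class X R w) = word_val G f w" if w: "w \<in> words X" for w
  proof -
    have "w \<in> word_class X R w"
      using w by (simp add: word_class_def pres_rel.refl)
    then have "(SOME v. v \<in> word_class X R w) \<in> word_class X R w"
      by (rule someI)
    then have "(w, SOME v. v \<in> word_class X R w) \<in> pres_rel X R"
      by (simp add: word_class_def)
    from word_val_pres_rel[OF f R this] show ?thesis
      using w by (simp add: \<phi>_def carrier_presented_group)
  qed
  have "\<phi> \<in> hom ?P G"
    by (rule homI)
      (auto simp: carrier_presented_group \<phi> word_class_mult words_append
        word_val_append[OF f] word_val_closed[OF f])
  moreover have "\<phi> (word_class X R [Gen x]) = f x" if "x \<in> X" for x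
  proof -
    have "[Gen x] \<in> words X" "f x \<in> carrier G"
      using that f by (auto simp: words_Cons words_Nil)
    then show ?thesis by (simp add: \<phi> word_val_simps)
  qed
  ultimately show "\<exists>\<phi>. \<phi> \<in> extensional (carrier ?P) \<and> \<phi> \<in> hom ?P G
      \<and> (\<forall>x\<in>X. \<phi> (word_class X R [Gen x]) = f x)"
    by (intro exI[of _ \<phi>]) (simp add: \<phi>_def)
next
  fix \<phi> \<psi>
  let ?E = "extensional (carrier (presented_group X R))"
  assume \<phi>: "\<phi> \<in> ?E \<and> \<phi> \<in> hom (presented_group X R) G
      \<and> (\<forall>x\<in>X. \<phi> (word_class X R [Gen x]) = f x)"
    and \<psi>: "\<psi> \<in> ?E \<and> \<psi> \<in> hom (presented_group X R) G
      \<and> (\<forall>x\<in>X. \<psi> (word_class X R [Gen x]) = f x)"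
  have val: "word_val G (\<lambda>x. \<chi> (word_class X R [Gen x])) w = word_val G f w"
    if "\<forall>x\<in>X. \<chi> (word_class X R [Gen x]) = f x" "w \<in> words X" for \<chi> w
    using that(2) by (induction w) (use that(1) in \<open>auto simp: word_val_simps words_Cons\<close>)
  show "\<phi> = \<psi>"
    by (rule extensionalityI[of _ "carrier (presented_group X R)"])
      (use \<phi> \<psi> val in \<open>auto simp: carrier_presented_group hom_word_class\<close>)
qed

end

section \<open>Permutation matrices in a rescaled basis\<close>

text \<open>
  This is \<open>D P D\<^sup>-\<^sup>1\<close>, where \<open>P\<close> is the permutation matrix of \<open>\<sigma>\<close> and \<open>D\<close> is the diagonal matrix
  with entries \<open>t\<^bsup>k r\<^esup>\<close>; hence the exponent depends on the difference of row and column only.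
\<close>

definition twisted_perm_mat :: "nat \<Rightarrow> int \<Rightarrow> (nat \<Rightarrow> nat) \<Rightarrow> laurent_poly mat"
  where "twisted_perm_mat n k \<sigma> =
    mat n n (\<lambda>(r, c). if r = \<sigma> c then t_pow (k * (int r - int c)) else 0)"

lemma twisted_perm_mat_carrier: "twisted_perm_mat n k \<sigma> \<in> carrier_mat n n"
  by (simp add: twisted_perm_mat_def)

lemma twisted_perm_mat_id: "twisted_perm_mat n k id = 1\<^sub>m n"
  by (rule eq_matI) (auto simp: twisted_perm_mat_def t_pow_0)

text \<open>
  The exponents telescope along \<open>c \<mapsto> \<tau> c \<mapsto> \<sigma> (\<tau> c)\<close>, which is the multiplicativity of
  conjugation by a fixed diagonal matrix.
\<close>

lemma twisted_perm_mat_mult: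
  assumes "\<tau> \<in> {..<n} \<rightarrow> {..<n}"
  shows "twisted_perm_mat n k \<sigma> * twisted_perm_mat n k \<tau> = twisted_perm_mat n k (\<sigma> \<circ> \<tau>)"
proof (rule eq_matI)
  fix r c assume rc: "r < dim_row (twisted_perm_mat n k (\<sigma> \<circ> \<tau>))"
    "c < dim_col (twisted_perm_mat n k (\<sigma> \<circ> \<tau>))"
  then have r: "r < n" and c: "c < n" by (auto simp: twisted_perm_mat_def)
  then have \<tau>: "\<tau> c < n" using assms by auto
  have "(twisted_perm_mat n k \<sigma> * twisted_perm_mat n k \<tau>) $$ (r, c)
      = (\<Sum>m\<in>{0..<n}. (if r = \<sigma> m then t_pow (k * (int r - int m)) else 0) *
          (if m = \<tau> c then t_pow (k * (int m - int c)) else 0))"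
    using r c by (simp add: twisted_perm_mat_def scalar_prod_def)
  also have "\<dots> = (\<Sum>m\<in>{0..<n}. if m = \<tau> c then
      (if r = \<sigma> (\<tau> c) then t_pow (k * (int r - int (\<tau> c))) else 0) *
        t_pow (k * (int (\<tau> c) - int c)) else 0)"
    by (intro sum.cong) auto
  also have "\<dots> = (if r = \<sigma> (\<tau> c) then t_pow (k * (int r - int (\<tau> c))) else 0) *
        t_pow (k * (int (\<tau> c) - int c))"
    using \<tau> by simp
  also have "\<dots> = (if r = \<sigma> (\<tau> c) then t_pow (k * (int r - int c)) else 0)"
    by (simp add: t_pow_add[symmetric] algebra_simps)
  finally show "(twisted_perm_mat n k \<sigma> * twisted_perm_mat n k \<tau>) $$ (r, c)
      = twisted_perm_mat n k (\<sigma> \<circ> \<tau>) $$ (r, c)"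
    using r c by (simp add: twisted_perm_mat_def)
qed (simp_all add: twisted_perm_mat_def)

lemma mat_mult_unit_vec:
  fixes A :: "'a :: comm_ring_1 mat"
  assumes "A \<in> carrier_mat n n" "c < n"
  shows "A *\<^sub>v unit_vec n c = col A c"
  by (rule eq_vecI) (use assms in auto)

lemma twisted_perm_mat_mult_unit_vec:
  assumes "c < n" "\<sigma> c < n"
  shows "twisted_perm_mat n k \<sigma> *\<^sub>v unit_vec n c
    = t_pow (k * (int (\<sigma> c) - int c)) \<cdot>\<^sub>v unit_vec n (\<sigma> c)"
  using assms by (subst mat_mult_unit_vec[OF twisted_perm_mat_carrier])
    (auto simp: twisted_perm_mat_def unit_vec_def)

text \<open>
  The columns of a matrix are the images of the standard basis vectors, so the prescribed actions
  leave no freedom. The matrix index \<open>i - 1\<close> belongs to the basis vector \<open>x\<^sub>i\<close>, so the generator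
  \<open>i\<close> swaps the positions \<open>i - 1\<close> and \<open>i\<close>.
\<close>

lemma eq_twisted_transpose_iff:
  assumes A: "A \<in> carrier_mat n n" and i: "i \<in> {1..n - 1}"
  shows "A = twisted_perm_mat n k (transpose (i - 1) i) \<longleftrightarrow>
      A *\<^sub>v std_basis n i = t_pow k \<cdot>\<^sub>v std_basis n (i + 1) \<and>
      A *\<^sub>v std_basis n (i + 1) = t_pow (- k) \<cdot>\<^sub>v std_basis n i \<and>
      (\<forall>j\<in>{1..n} - {i, i + 1}. A *\<^sub>v std_basis n j = std_basis n j)"
    (is "A = ?T \<longleftrightarrow> ?acts A")
proof -
  have T: "?acts ?T"
  proof (intro conjI ballI)
    show "?T *\<^sub>v std_basis n i = t_pow k \<cdot>\<^sub>v std_basis n (i + 1)"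
      using i by (auto simp: std_basis_def twisted_perm_mat_mult_unit_vec of_nat_diff)
    show "?T *\<^sub>v std_basis n (i + 1) = t_pow (- k) \<cdot>\<^sub>v std_basis n i"
      using i by (auto simp: std_basis_def twisted_perm_mat_mult_unit_vec of_nat_diff)
    fix j assume j: "j \<in> {1..n} - {i, i + 1}"
    then have "transpose (i - 1) i (j - 1) = j - 1"
      using i by (intro transpose_apply_other) auto
    then show "?T *\<^sub>v std_basis n j = std_basis n j"
      using j by (auto simp: std_basis_def twisted_perm_mat_mult_unit_vec t_pow_0)
  qed
  have "A = ?T" if acts: "?acts A"
  proof (rule mat_col_eqI)
    fix c assume "c < dim_col ?T"
    then have c: "c < n" by (simp add: twisted_perm_mat_def)
    have "A *\<^sub>v std_basis n (c + 1) = ?T *\<^sub>v std_basis n (c + 1)"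
    proof (cases "c + 1 \<in> {i, i + 1}")
      case True
      then show ?thesis using acts T by auto
    next
      case False
      then have "c + 1 \<in> {1..n} - {i, i + 1}" using c by auto
      then show ?thesis using acts T by metis
    qed
    then show "col A c = col ?T c"
      using c mat_mult_unit_vec[OF A] mat_mult_unit_vec[OF twisted_perm_mat_carrier]
      by (simp add: std_basis_def)
  qed (use A in \<open>auto simp: twisted_perm_mat_def\<close>)
  with T show ?thesis by blast
qed

section \<open>The representation of the triplet group\<close>

lemma monoid_ring_mat: "monoid (ring_mat TYPE('a :: comm_ring_1) n b)"
  using ring_mat[of n b] ring.is_monoid by blast

lemma group_GL: "group (GL TYPE('a :: comm_ring_1) n)"
  unfolding GL_def by (rule monoid.units_group[OF monoid_ring_mat])

lemma GL_simps:
  "\<one>\<^bsub>GL ty n\<^esub> = 1\<^sub>m n"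
  "A \<otimes>\<^bsub>GL ty n\<^esub> B = A * B"
  by (simp_all add: GL_def units_of_def ring_mat_def)

lemma GL_carrier_mat: "A \<in> carrier (GL ty n) \<Longrightarrow> A \<in> carrier_mat n n"
  by (auto simp: GL_def units_of_def ring_mat_def Units_def)

lemma involution_in_GL:
  assumes "A \<in> carrier_mat n n" "A * A = 1\<^sub>m n"
  shows "A \<in> carrier (GL ty n)"
  using assms by (auto simp: GL_def units_of_def ring_mat_def Units_def)

lemma transpose_less_n:
  fixes i n :: nat
  assumes "i \<in> {1..n - 1}"
  shows "transpose (i - 1) i \<in> {..<n} \<rightarrow> {..<n}"
proof -
  have "i < n" "i - 1 < n" using assms by auto
  then show ?thesis by (simp add: transpose_def Pi_iff)
qed

lemma twisted_transpose_square:
  assumes "i \<in> {1..n - 1}"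
  shows "twisted_perm_mat n k (transpose (i - 1) i) * twisted_perm_mat n k (transpose (i - 1) i)
    = 1\<^sub>m n"
  unfolding twisted_perm_mat_mult[OF transpose_less_n[OF assms]]
  by (simp only: transpose_comp_involutory twisted_perm_mat_id)

text \<open>
  Both sides of the braid relation are the twisted matrix of the transposition of \<open>i - 1\<close> and
  \<open>i + 1\<close>.
\<close>

lemma twisted_transpose_braid:
  fixes k :: int
  assumes "1 \<le> i" "i \<le> n - 2"
  defines "A \<equiv> \<lambda>j. twisted_perm_mat n k (transpose (j - 1) j)"
  shows "A i * (A (i + 1) * A i) = A (i + 1) * (A i * A (i + 1))"
proof -
  define \<sigma> \<tau> where "\<sigma> = transpose (i - 1) i" and "\<tau> = transpose i (i + 1)"
  have less: "\<sigma> \<in> {..<n} \<rightarrow> {..<n}" "\<tau> \<in> {..<n} \<rightarrow> {..<n}"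
    using transpose_less_n[of i n] transpose_less_n[of "i + 1" n] assms(1,2)
    by (auto simp: \<sigma>_def \<tau>_def)
  then have comp: "\<sigma> \<circ> \<tau> \<in> {..<n} \<rightarrow> {..<n}" "\<tau> \<circ> \<sigma> \<in> {..<n} \<rightarrow> {..<n}"
    by auto
  have A: "A i = twisted_perm_mat n k \<sigma>" "A (i + 1) = twisted_perm_mat n k \<tau>"
    by (simp_all add: A_def \<sigma>_def \<tau>_def)
  have "\<sigma> \<circ> (\<tau> \<circ> \<sigma>) = \<tau> \<circ> (\<sigma> \<circ> \<tau>)"
    using assms(1) by (auto simp: fun_eq_iff transpose_def \<sigma>_def \<tau>_def)
  then show ?thesis
    unfolding A twisted_perm_mat_mult[OF less(1)] twisted_perm_mat_mult[OF less(2)]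
      twisted_perm_mat_mult[OF comp(1)] twisted_perm_mat_mult[OF comp(2)]
    by simp
qed

theorem theorem13:
  fixes n :: nat and k :: int
  assumes "n \<ge> 2"
  shows "\<exists>!\<mu>. \<mu> \<in> extensional (carrier (triplet_group n)) \<and>
    group_hom (triplet_group n) (GL TYPE(laurent_poly) n) \<mu> \<and>
    (\<forall>i\<in>{1..n - 1}.
      \<mu> (triplet_gen n i) *\<^sub>v std_basis n i = t_pow k \<cdot>\<^sub>v std_basis n (i + 1) \<and>
      \<mu> (triplet_gen n i) *\<^sub>v std_basis n (i + 1) = t_pow (- k) \<cdot>\<^sub>v std_basis n i \<and>
      (\<forall>j\<in>{1..n} - {i, i + 1}. \<mu> (triplet_gen n i) *\<^sub>v std_basis n j = std_basis n j))"
proof -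
  let ?L = "triplet_group n" and ?G = "GL TYPE(laurent_poly) n"
  let ?T = "\<lambda>i. twisted_perm_mat n k (transpose (i - 1) i)"
  let ?acts = "\<lambda>i A. A *\<^sub>v std_basis n i = t_pow k \<cdot>\<^sub>v std_basis n (i + 1) \<and>
      A *\<^sub>v std_basis n (i + 1) = t_pow (- k) \<cdot>\<^sub>v std_basis n i \<and>
      (\<forall>j\<in>{1..n} - {i, i + 1}. A *\<^sub>v std_basis n j = std_basis n j)"
  have "?T \<in> triplet_gens n \<rightarrow> carrier ?G"
    unfolding triplet_gens_def
    by (intro funcsetI involution_in_GL twisted_perm_mat_carrier twisted_transpose_square)
  moreover have "word_val ?G ?T u = word_val ?G ?T v" if "(u, v) \<in> triplet_rels n" for u v
  proof -
    from that consider
      i where "i \<in> {1..n - 1}" "u = [Gen i, Gen i]" "v = []"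
    | i where "1 \<le> i" "i \<le> n - 2"
        "u = [Gen i, Gen (i + 1), Gen i]" "v = [Gen (i + 1), Gen i, Gen (i + 1)]"
      unfolding triplet_rels_def by fastforce
    then show ?thesis
    proof cases
      case 1
      then show ?thesis
        using twisted_transpose_square[OF 1(1), of k]
        by (simp add: word_val_simps GL_simps
            right_mult_one_mat[OF twisted_perm_mat_carrier])
    next
      case 2
      then show ?thesis
        using twisted_transpose_braid[OF 2(1,2), of k]
        by (simp add: word_val_simps GL_simps
            right_mult_one_mat[OF twisted_perm_mat_carrier])
    qed
  qed
  ultimately have univ: "\<exists>!\<mu>. \<mu> \<in> extensional (carrier ?L) \<and> \<mu> \<in> hom ?L ?G \<and>
      (\<forall>i\<in>{1..n - 1}. \<mu> (triplet_gen n i) = ?T i)"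
    using group.presented_group_universal[OF group_GL, of ?T "triplet_gens n" n "triplet_rels n"]
    unfolding triplet_group_def triplet_gen_def by (simp only: triplet_gens_def)
  have "\<mu> (triplet_gen n i) = ?T i \<longleftrightarrow> ?acts i (\<mu> (triplet_gen n i))"
    if "\<mu> \<in> hom ?L ?G" "i \<in> {1..n - 1}" for \<mu> i
  proof (rule eq_twisted_transpose_iff[OF GL_carrier_mat that(2)])
    have "triplet_gen n i \<in> carrier ?L"
      using that(2) by (simp add: triplet_gen_def triplet_group_def carrier_presented_group
          triplet_gens_def words_Cons words_Nil)
    then show "\<mu> (triplet_gen n i) \<in> carrier ?G"
      using that(1) by (rule hom_in_carrier[rotated])
  qed
  moreover have "group_hom ?L ?G \<mu> \<longleftrightarrow> \<mu> \<in> hom ?L ?G" for \<mu>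
    by (simp add: group_hom_def group_hom_axioms_def group_GL group_presented_group
        triplet_group_def)
  ultimately have "(\<mu> \<in> extensional (carrier ?L) \<and> group_hom ?L ?G \<mu> \<and>
        (\<forall>i\<in>{1..n - 1}. ?acts i (\<mu> (triplet_gen n i)))) \<longleftrightarrow>
      (\<mu> \<in> extensional (carrier ?L) \<and> \<mu> \<in> hom ?L ?G \<and>
        (\<forall>i\<in>{1..n - 1}. \<mu> (triplet_gen n i) = ?T i))" for \<mu>
    by metis
  then show ?thesis
    using univ by presburger
qed

end
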